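(* Let $h\ge2$ be an integer. For every multiplicative basis $A$ of order $h$ for $\mathbb{Z}^+$, we have $$\limsup_{x\to\infty}A(x)\frac{(\log x)^{1-\frac1h}}{x}>\frac1e.$$
   Context: $\mathbb{Z}^+$ denotes the set of positive integers, $\log$ the natural logarithm, and $e$ its base. A set $A\subseteq\mathbb{Z}^+$ is a multiplicative basis of order $h$ for $\mathbb{Z}^+$ if every positive integer can be written in the form $a_1\cdots a_h$ with $a_i\in A$ for all $1\le i\le h$ (repetitions allowed). The counting function of $A$ is $A(x)=|\{a\in A:a\le x\}|$. A limsup may equal $+\infty$. *)

theory Defs
  imports "HOL-Analysis.Analysis"
begin

definition multiplicative_basis :: "nat \<Rightarrow> nat set \<Rightarrow> bool" where
  "multiplicative_basis h A \<longleftrightarrow>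
     A \<subseteq> {0<..} \<and>
     (\<forall>n>0. \<exists>a. (\<forall>i\<in>{1..h}. a i \<in> A) \<and> n = (\<Prod>i=1..h. a i))"

definition counting_function :: "nat set \<Rightarrow> real \<Rightarrow> nat" where
  "counting_function A x = card {a \<in> A. real a \<le> x}"

end

theory Submission
  imports Defs
begin

text \<open>
  Raikov's argument with a factor \<open>h!\<close> gained from the order of the factors. For
  \<open>s = 1 + \<sigma> > 1\<close>, let \<open>F(s)\<close> be the sum of \<open>a powr -s\<close> over \<open>a \<in> A\<close>. Every \<open>n\<close> is either a
  product of \<open>h\<close> distinct elements of \<open>A\<close>, and is then counted \<open>h!\<close> times by \<open>F(s)^h\<close>, or has the
  form \<open>b\<^sup>2 m\<close> with \<open>m\<close> a product of \<open>h - 2\<close> elements. Hence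
  \<open>1 / \<sigma> \<le> \<zeta>(s) \<le> F(s)^h / h! + O(F(s)^(h-2))\<close>. If \<open>A(x) \<le> c x (ln x) powr (1/h - 1)\<close> for large \<open>x\<close>,
  partial summation gives \<open>F(s) \<le> s (O(1) + c \<Gamma>(1/h) \<sigma> powr (-1/h))\<close>, and \<open>\<sigma> \<rightarrow> 0\<close> yields
  \<open>h! \<le> (c \<Gamma>(1/h))^h \<le> (c h)^h\<close>. Since \<open>h! > (h/e)^h\<close>, some \<open>c > 1/e\<close> violates this.
\<close>

section \<open>Products of \<open>k\<close> factors from a set, repetitions allowed\<close>

text \<open>Multisets forget the order of the factors and make a repeated factor visible as a
  \<open>count\<close> of at least 2.\<close>

definition products :: "nat set \<Rightarrow> nat \<Rightarrow> nat set" where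
  "products B k = prod_mset ` {M. set_mset M \<subseteq> B \<and> size M = k}"

lemma products_0: "products B 0 = {1}"
  by (auto simp: products_def)

lemma products_Suc: "products B (Suc k) = (\<lambda>(a, m). a * m) ` (B \<times> products B k)"
proof (intro equalityI subsetI)
  fix n assume "n \<in> products B (Suc k)"
  then obtain M where M: "set_mset M \<subseteq> B" "size M = Suc k" "n = prod_mset M"
    by (auto simp: products_def)
  then obtain a M' where "M = add_mset a M'"
    by (metis size_eq_Suc_imp_eq_union)
  then show "n \<in> (\<lambda>(a, m). a * m) ` (B \<times> products B k)"
    using M by (auto simp: products_def image_iff intro!: bexI[of _ "(a, prod_mset M')"])
next
  fix n assume "n \<in> (\<lambda>(a, m). a * m) ` (B \<times> products B k)"
  then obtain a M where "a \<in> B" "set_mset M \<subseteq> B" "size M = k" "n = prod_mset (add_mset a M)"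
    by (auto simp: products_def)
  then show "n \<in> products B (Suc k)"
    unfolding products_def by (intro image_eqI[of _ _ "add_mset a M"]) auto
qed

lemma finite_products: "finite B \<Longrightarrow> finite (products B k)"
  by (induction k) (auto simp: products_0 products_Suc)

text \<open>A multiset of factors without repetition is a set; otherwise two copies of some
  \<open>b\<close> split off and \<open>k\<close> factors remain.\<close>

lemma products_Suc_Suc_subset:
  assumes "finite B"
  shows "products B (Suc (Suc k)) \<subseteq>
    \<Prod> ` {X. X \<subseteq> B \<and> card X = Suc (Suc k)} \<union> (\<lambda>(b, m). b * b * m) ` (B \<times> products B k)"
proof
  fix n assume "n \<in> products B (Suc (Suc k))"
  then obtain M where M: "set_mset M \<subseteq> B" "size M = Suc (Suc k)" "n = prod_mset M"
    by (auto simp: products_def)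
  show "n \<in> \<Prod> ` {X. X \<subseteq> B \<and> card X = Suc (Suc k)} \<union> (\<lambda>(b, m). b * b * m) ` (B \<times> products B k)"
  proof (cases "\<exists>b. count M b \<ge> 2")
    case True
    then obtain b where b: "count M b \<ge> 2" by blast
    then have "{#b, b#} \<subseteq># M"
      by (auto simp: subseteq_mset_def)
    then obtain M' where M': "M = {#b, b#} + M'"
      by (metis mset_subset_eq_exists_conv)
    then have "b \<in> B" "prod_mset M' \<in> products B k" "n = b * b * prod_mset M'"
      using M by (auto simp: products_def)
    then show ?thesis by (force intro!: image_eqI[of _ _ "(b, prod_mset M')"])
  next
    case False
    then have "count M x \<le> 1" for x by (metis Suc_1 not_less_eq_eq)
    then have "count M x = (if x \<in># M then 1 else 0)" for x
      by (metis count_greater_eq_one_iff le_antisym not_in_iff)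
    then have "M = mset_set (set_mset M)"
      by (intro multiset_eqI) (simp add: count_mset_set')
    then have "n = \<Prod>(set_mset M)" "card (set_mset M) = Suc (Suc k)"
      using M by (metis prod_unfold_prod_mset image_mset_id id_apply multiset.map_ident, metis size_mset_set)
    then show ?thesis using M by blast
  qed
qed

section \<open>Sums of multiplicative weights over products\<close>

text \<open>The omitted terms of the binomial expansion are nonnegative. Below, \<open>x\<close> is
  the weight of one element adjoined to a set of total weight \<open>p\<close>.\<close>

lemma power_Suc_add_ge:
  fixes p x :: real
  assumes "p \<ge> 0" "x \<ge> 0"
  shows "p ^ Suc k + real (Suc k) * x * p ^ k \<le> (p + x) ^ Suc k"
proof (induction k)
  case (Suc k)
  have "p ^ Suc (Suc k) + real (Suc (Suc k)) * x * p ^ Suc k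
      \<le> (p + x) * (p ^ Suc k + real (Suc k) * x * p ^ k)"
    using assms by (simp add: algebra_simps)
  also have "\<dots> \<le> (p + x) * (p + x) ^ Suc k"
    using assms by (intro mult_left_mono Suc) auto
  finally show ?case by simp
qed auto

text \<open>Expanding \<open>sum w B ^ k\<close> yields the product over each
  \<open>k\<close>-element set once per ordering, so \<open>fact k\<close> times, plus nonnegative
  terms. The induction on \<open>B\<close> splits the sets by whether they contain the new
  element.\<close>

lemma elementary_symmetric_le:
  fixes w :: "'a \<Rightarrow> real"
  assumes "finite B" "\<And>a. w a \<ge> 0"
  shows "(\<Sum>X | X \<subseteq> B \<and> card X = k. \<Prod>a\<in>X. w a) \<le> sum w B ^ k / fact k"
  using assms(1)
proof (induction B arbitrary: k rule: finite_induct)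
  case empty
  have "{X::'a set. X = {} \<and> card X = k} = (if k = 0 then {{}} else {})" by auto
  then show ?case by auto
next
  case (insert b B)
  show ?case
  proof (cases k)
    case 0
    have "{X. X \<subseteq> insert b B \<and> card X = 0} = {{}}"
      using insert.hyps by (auto dest: finite_subset)
    then show ?thesis using 0 by simp
  next
    case (Suc j)
    let ?S = "\<lambda>i. {X. X \<subseteq> B \<and> card X = i}"
    let ?p = "sum w B"
    have fin: "finite (?S i)" for i using insert.hyps by simp
    have split: "{X. X \<subseteq> insert b B \<and> card X = Suc j} = ?S (Suc j) \<union> insert b ` ?S j"
    proof (intro equalityI subsetI)
      fix X assume X: "X \<in> {X. X \<subseteq> insert b B \<and> card X = Suc j}"
      show "X \<in> ?S (Suc j) \<union> insert b ` ?S j"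
      proof (cases "b \<in> X")
        case True
        then have "X = insert b (X - {b})" "X - {b} \<in> ?S j" using X by auto
        then show ?thesis by blast
      qed (use X in auto)
    next
      fix X assume "X \<in> ?S (Suc j) \<union> insert b ` ?S j"
      then show "X \<in> {X. X \<subseteq> insert b B \<and> card X = Suc j}"
        using insert.hyps by (auto simp: finite_subset card_insert_if)
    qed
    have inj: "inj_on (insert b) (?S j)"
      using insert.hyps by (auto simp: inj_on_def)
    have "(\<Sum>X | X \<subseteq> insert b B \<and> card X = k. \<Prod>a\<in>X. w a)
        = (\<Sum>X\<in>?S (Suc j). \<Prod>a\<in>X. w a) + (\<Sum>X\<in>insert b ` ?S j. \<Prod>a\<in>X. w a)"
      unfolding Suc split using insert.hyps fin by (intro sum.union_disjoint) auto
    also have "(\<Sum>X\<in>insert b ` ?S j. \<Prod>a\<in>X. w a) = (\<Sum>X\<in>?S j. w b * (\<Prod>a\<in>X. w a))"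
      unfolding sum.reindex[OF inj] o_def
      using insert.hyps by (intro sum.cong refl prod.insert) (auto dest: finite_subset)
    also have "\<dots> = w b * (\<Sum>X\<in>?S j. \<Prod>a\<in>X. w a)" by (simp add: sum_distrib_left)
    also have "(\<Sum>X\<in>?S (Suc j). \<Prod>a\<in>X. w a) + w b * (\<Sum>X\<in>?S j. \<Prod>a\<in>X. w a)
        \<le> ?p ^ Suc j / fact (Suc j) + w b * (?p ^ j / fact j)"
      using assms(2) by (intro add_mono mult_left_mono insert.IH) auto
    also have "\<dots> = (?p ^ Suc j + real (Suc j) * w b * ?p ^ j) / fact (Suc j)"
      by (simp add: divide_simps)
    also have "\<dots> \<le> (?p + w b) ^ Suc j / fact (Suc j)"
      using assms(2) by (intro divide_right_mono power_Suc_add_ge sum_nonneg) auto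
    also have "?p + w b = sum w (insert b B)" using insert.hyps by simp
    finally show ?thesis using Suc by simp
  qed
qed

text \<open>Later \<open>w n\<close> is \<open>real n powr -(1 + \<sigma>)\<close> and
  \<open>B\<close> is \<open>A\<close> cut off at \<open>N\<close>, so that all sums are
  finite.\<close>

context
  fixes w :: "nat \<Rightarrow> real" and B :: "nat set"
  assumes w_nonneg: "\<And>n. w n \<ge> 0" and w_1: "w 1 = 1" and w_mult: "\<And>m n. w (m * n) = w m * w n"
    and finite_B: "finite B"
begin

lemma w_prod: "w (\<Prod>X) = (\<Prod>a\<in>X. w a)"
  using w_1 w_mult by (induction X rule: infinite_finite_induct) auto

text \<open>Each value counts once on the left, but once per ordered representation on the right.
  Losing the factorial is harmless, since this bound only serves the remainder term.\<close>

lemma sum_products_le: "sum w (products B k) \<le> sum w B ^ k"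
proof (induction k)
  case (Suc k)
  have "sum w (products B (Suc k)) \<le> (\<Sum>(a, m)\<in>B \<times> products B k. w a * w m)"
    unfolding products_Suc
    by (rule order.trans[OF sum_image_le])
      (auto simp: finite_B finite_products w_nonneg w_mult o_def case_prod_unfold)
  also have "\<dots> = sum w B * sum w (products B k)"
    by (simp add: sum_product sum.cartesian_product)
  also have "\<dots> \<le> sum w B * sum w B ^ k"
    by (intro mult_left_mono Suc sum_nonneg w_nonneg)
  finally show ?case by simp
qed (use w_1 in \<open>simp add: products_0\<close>)

text \<open>Distinct factors give the first term. The numbers \<open>b * b * m\<close> give the
  second, which is of lower order as long as the sum of squares stays bounded.\<close>

lemma sum_products_Suc_Suc_le:
  "sum w (products B (Suc (Suc k)))
    \<le> sum w B ^ Suc (Suc k) / fact (Suc (Suc k)) + (\<Sum>b\<in>B. (w b)\<^sup>2) * sum w B ^ k"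
proof -
  let ?S = "{X. X \<subseteq> B \<and> card X = Suc (Suc k)}"
  let ?T = "B \<times> products B k"
  have fin: "finite ?S" "finite ?T" using finite_B by (auto simp: finite_products)
  have "sum w (products B (Suc (Suc k))) \<le> sum w (\<Prod> ` ?S \<union> (\<lambda>(b, m). b * b * m) ` ?T)"
    using fin by (intro sum_mono2 products_Suc_Suc_subset finite_B w_nonneg) auto
  also have "\<dots> \<le> sum w (\<Prod> ` ?S) + sum w ((\<lambda>(b, m). b * b * m) ` ?T)"
    using fin by (simp add: sum_Un sum_nonneg w_nonneg)
  also have "sum w (\<Prod> ` ?S) \<le> (\<Sum>X\<in>?S. \<Prod>a\<in>X. w a)"
    using fin by (intro order.trans[OF sum_image_le]) (auto simp: w_nonneg w_prod prod_nonneg)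
  also have "\<dots> \<le> sum w B ^ Suc (Suc k) / fact (Suc (Suc k))"
    by (intro elementary_symmetric_le finite_B w_nonneg)
  also have "sum w ((\<lambda>(b, m). b * b * m) ` ?T) \<le> (\<Sum>(b, m)\<in>?T. (w b)\<^sup>2 * w m)"
    using fin by (intro order.trans[OF sum_image_le])
      (auto simp: w_nonneg w_mult o_def case_prod_unfold power2_eq_square)
  also have "\<dots> = (\<Sum>b\<in>B. (w b)\<^sup>2) * sum w (products B k)"
    by (simp add: sum_product sum.cartesian_product)
  also have "\<dots> \<le> (\<Sum>b\<in>B. (w b)\<^sup>2) * sum w B ^ k"
    by (intro mult_left_mono sum_products_le sum_nonneg) auto
  finally show ?thesis by simp
qed

end

text \<open>The factors of \<open>n\<close> divide it, so they are at most \<open>N\<close> and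
  survive the cut-off.\<close>

lemma basis_subset_products:
  assumes "multiplicative_basis h A"
  shows "{1..N} \<subseteq> products (A \<inter> {1..N}) h"
proof
  fix n assume n: "n \<in> {1..N}"
  then obtain a where a: "\<forall>i\<in>{1..h}. a i \<in> A" "n = (\<Prod>i=1..h. a i)"
    using assms unfolding multiplicative_basis_def by (metis atLeastAtMost_iff less_le_trans zero_less_one)
  have "a i \<in> A \<inter> {1..N}" if "i \<in> {1..h}" for i
  proof -
    have "a i dvd n" using that a by auto
    then have "a i \<le> n" "a i > 0" using n by (auto dest: dvd_imp_le intro: Nat.gr0I)
    then show ?thesis using a that n by auto
  qed
  then show "n \<in> products (A \<inter> {1..N}) h"
    unfolding products_def using a(2)
    by (intro image_eqI[of _ _ "image_mset a (mset_set {1..h})"]) (auto simp: prod_unfold_prod_mset)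
qed

section \<open>Lower bound for the truncated zeta sum\<close>

text \<open>The left side is the integral of \<open>u powr -(1 + \<sigma>)\<close> from 1 to
  \<open>N + 1\<close>. The mean value theorem compares each unit interval with the value at its
  left end.\<close>

lemma sum_powr_ge:
  fixes \<sigma> :: real
  assumes "\<sigma> > 0"
  shows "(1 - (1 + real N) powr -\<sigma>) / \<sigma> \<le> (\<Sum>n=1..N. real n powr -(1 + \<sigma>))"
proof (induction N)
  case (Suc N)
  have "\<exists>z>real N + 1. z < real N + 2 \<and>
      (real N + 2) powr -\<sigma> - (real N + 1) powr -\<sigma> = (real N + 2 - (real N + 1)) * (-\<sigma> * z powr (-\<sigma> - 1))"
    by (rule MVT2) (auto intro!: derivative_eq_intros simp: powr_diff field_simps)
  then obtain z where z: "z > real N + 1"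
    "(real N + 1) powr -\<sigma> - (real N + 2) powr -\<sigma> = \<sigma> * z powr (-\<sigma> - 1)"
    by (auto simp: algebra_simps)
  have "z powr (-\<sigma> - 1) \<le> (real N + 1) powr (-\<sigma> - 1)"
    using z assms by (intro powr_mono2') auto
  then have "((real N + 1) powr -\<sigma> - (real N + 2) powr -\<sigma>) / \<sigma> \<le> (real N + 1) powr (-\<sigma> - 1)"
    using z assms by simp
  moreover have "(1 - (1 + real (Suc N)) powr -\<sigma>) / \<sigma> =
     (1 - (1 + real N) powr -\<sigma>) / \<sigma> + ((real N + 1) powr -\<sigma> - (real N + 2) powr -\<sigma>) / \<sigma>"
    by (simp add: add_divide_distrib[symmetric] add.commute)
  ultimately show ?case using Suc by (simp add: add.commute minus_diff_commute)
qed auto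

section \<open>Upper bound for the Dirichlet sum over the basis\<close>

text \<open>Substitute \<open>t = \<sigma> * u\<close> in Euler's integral. With nonnegative
  integrals, integrability follows from the finite value.\<close>

lemma Gamma_integral_scaled:
  fixes x \<sigma> :: real
  assumes "x > 0" "\<sigma> > 0"
  shows "((\<lambda>u. u powr (x - 1) * exp (-\<sigma> * u)) has_integral Gamma x / \<sigma> powr x) {0..}"
proof -
  let ?f = "\<lambda>t::real. ennreal (indicator {0..} t * t powr (x - 1) / exp t)"
  let ?g = "\<lambda>u::real. indicator {0..} u * (u powr (x - 1) * exp (-\<sigma> * u))"
  have f: "?f (0 + \<sigma> * u) = ennreal (\<sigma> powr (x - 1)) * ennreal (?g u)" for u
  proof (cases "u \<ge> 0")
    case True
    then show ?thesis using assms
      by (simp add: ennreal_mult' [symmetric] powr_mult exp_minus divide_inverse mult.assoc zero_le_mult_iff)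
  next
    case False
    then have "\<not> \<sigma> * u \<ge> 0" using assms by (simp add: zero_le_mult_iff)
    then show ?thesis using False by simp
  qed
  have "ennreal (Gamma x) = ennreal \<sigma> * (\<integral>\<^sup>+u. ?f (0 + \<sigma> * u) \<partial>lborel)"
    using assms by (subst Gamma_conv_nn_integral_real, simp, subst nn_integral_real_affine[of _ \<sigma> 0]) auto
  also have "\<dots> = ennreal (\<sigma> powr x) * (\<integral>\<^sup>+u. ennreal (?g u) \<partial>lborel)"
    unfolding f using assms
    by (subst nn_integral_cmult) (auto simp: mult.assoc[symmetric] ennreal_mult' [symmetric] powr_diff)
  finally have "(\<integral>\<^sup>+u. ennreal (?g u) \<partial>lborel) = ennreal (Gamma x) / ennreal (\<sigma> powr x)"
    using assms by (simp add: mult.commute[of "ennreal (\<sigma> powr x)"] ennreal_mult_divide_eq)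
  then have "(\<integral>\<^sup>+u. ennreal (?g u) \<partial>lborel) = ennreal (Gamma x / \<sigma> powr x)"
    using assms by (simp add: divide_ennreal Gamma_real_pos less_imp_le)
  then have "(?g has_integral Gamma x / \<sigma> powr x) UNIV"
    using assms by (intro nn_integral_has_integral) (auto simp: Gamma_real_pos less_imp_le)
  then show ?thesis
    by (subst has_integral_restrict_UNIV[symmetric])
      (auto elim!: has_integral_eq[rotated] simp: indicator_def)
qed

lemma sum_basis_powr_le:
  fixes A :: "nat set" and c x U \<sigma> :: real
  assumes "c \<ge> 0" "x > 0" "\<sigma> > 0" "U \<ge> 0" "0 \<notin> A"
    and bound: "\<And>u. u > U \<Longrightarrow> real (counting_function A (exp u)) \<le> c * exp u * u powr (x - 1)"
  shows "(\<Sum>a\<in>A \<inter> {1..N}. real a powr -(1 + \<sigma>)) \<le> (1 + \<sigma>) * (U + c * Gamma x / \<sigma> powr x)"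
proof -
  text \<open>Partial summation in the form \<open>real a powr -s = (\<integral>u\<in>{ln a..}. s * exp (-s * u))\<close>.\<close>
  define B where "B = A \<inter> {1..N}"
  have B: "finite B" "\<And>a. a \<in> B \<Longrightarrow> a \<ge> 1" by (auto simp: B_def)
  let ?f = "\<lambda>a u. if u \<in> {ln (real a)..} then exp (-(1 + \<sigma>) * u) else 0"
  \<comment> \<open>Majorant of the summed integrands: 1 up to \<open>U\<close>, from the trivial
    count, and a Gamma integrand beyond it, from \<open>bound\<close>. The factor
    \<open>1 + \<sigma>\<close> is restored at the end.\<close>
  let ?g = "\<lambda>u::real. (if u \<in> {0..U} then 1 else 0) + c * (u powr (x - 1) * exp (-\<sigma> * u))"
  have "(?f a has_integral real a powr -(1 + \<sigma>) / (1 + \<sigma>)) {0..}" if "a \<in> B" for a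
    using has_integral_exp_minus_to_infinity[of "1 + \<sigma>" "ln (real a)"] assms B(2)[OF that]
    by (subst has_integral_restrict) (auto simp: powr_def)
  then have 1: "((\<lambda>u. \<Sum>a\<in>B. ?f a u) has_integral (\<Sum>a\<in>B. real a powr -(1 + \<sigma>) / (1 + \<sigma>))) {0..}"
    by (intro has_integral_sum B) auto
  have "((\<lambda>u::real. 1::real) has_integral U) {0..U}"
    using has_integral_const_real[of "1::real" 0 U] assms by simp
  then have "((\<lambda>u::real. if u \<in> {0..U} then 1 else 0::real) has_integral U) {0..}"
    by (subst has_integral_restrict) auto
  then have 2: "(?g has_integral U + c * (Gamma x / \<sigma> powr x)) {0..}"
    by (intro has_integral_add has_integral_mult_right Gamma_integral_scaled assms)
  have "(\<Sum>a\<in>B. ?f a u) \<le> ?g u" if u: "u \<in> {0..}" for u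
  proof -
    have fin: "finite {a \<in> A. real a \<le> exp u}"
      by (rule finite_subset[of _ "{..nat \<lfloor>exp u\<rfloor>}"]) (auto simp: le_nat_floor)
    have "(\<Sum>a\<in>B. ?f a u) = real (card {a \<in> B. real a \<le> exp u}) * exp (-(1 + \<sigma>) * u)"
    proof -
      have "ln (real a) \<le> u \<longleftrightarrow> real a \<le> exp u" if "a \<in> B" for a
        using B(2)[OF that] by (metis exp_le_cancel_iff exp_ln of_nat_0_less_iff zero_less_one less_le_trans)
      then have "(\<Sum>a\<in>B. ?f a u) = (\<Sum>a\<in>B. if real a \<le> exp u then exp (-(1 + \<sigma>) * u) else 0)"
        by (intro sum.cong) auto
      also have "\<dots> = real (card {a \<in> B. real a \<le> exp u}) * exp (-(1 + \<sigma>) * u)"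
        using B by (simp add: sum.If_cases Int_def)
      finally show ?thesis .
    qed
    also have "\<dots> \<le> real (counting_function A (exp u)) * exp (-(1 + \<sigma>) * u)"
      unfolding counting_function_def B_def
      by (intro mult_right_mono of_nat_mono card_mono fin) auto
    also have "\<dots> \<le> ?g u"
    proof (cases "u > U")
      case True
      have "real (counting_function A (exp u)) * exp (-(1 + \<sigma>) * u)
          \<le> (c * exp u * u powr (x - 1)) * exp (-(1 + \<sigma>) * u)"
        by (intro mult_right_mono bound True) auto
      also have "\<dots> = c * (u powr (x - 1) * exp (-\<sigma> * u))"
        by (simp add: algebra_simps exp_add exp_minus field_simps exp_diff)
      finally show ?thesis using True by simp
    next
      case False
      \<comment> \<open>Up to \<open>U\<close> only the trivial count is available; since 0 is
        excluded it is at most \<open>exp u\<close>.\<close>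
      have "{a \<in> A. real a \<le> exp u} \<subseteq> {1..nat \<lfloor>exp u\<rfloor>}"
        using \<open>0 \<notin> A\<close> by (auto simp: le_nat_floor Suc_le_eq intro: Nat.gr0I)
      from card_mono[OF _ this] have "counting_function A (exp u) \<le> nat \<lfloor>exp u\<rfloor>"
        by (simp add: counting_function_def)
      then have "real (counting_function A (exp u)) \<le> exp u"
        by (metis exp_ge_zero le_nat_floor of_nat_floor of_nat_mono order_trans)
      then have "real (counting_function A (exp u)) * exp (-(1 + \<sigma>) * u) \<le> exp u * exp (-(1 + \<sigma>) * u)"
        by (intro mult_right_mono) auto
      also have "\<dots> = exp (-\<sigma> * u)" by (simp add: exp_add[symmetric] algebra_simps)
      also have "\<dots> \<le> 1" using assms u by simp
      also have "\<dots> \<le> ?g u" using False u assms by simp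
      finally show ?thesis .
    qed
    finally show ?thesis .
  qed
  from has_integral_le[OF 1 2 this]
  have "(\<Sum>a\<in>B. real a powr -(1 + \<sigma>)) / (1 + \<sigma>) \<le> U + c * Gamma x / \<sigma> powr x"
    by (simp add: sum_divide_distrib)
  then show ?thesis using assms by (simp add: B_def field_simps)
qed

section \<open>Estimates for Gamma and the factorial\<close>

text \<open>Log-convexity and \<open>Gamma 1 = Gamma 2 = 1\<close> give
  \<open>Gamma (1 + 1 / h) \<le> 1\<close>; the functional equation does the rest.\<close>

lemma Gamma_inverse_le:
  fixes h :: nat
  assumes "h \<ge> 1"
  shows "Gamma (1 / real h) \<le> real h"
proof -
  let ?x = "1 / real h"
  have "(ln \<circ> Gamma) ((1 - ?x) *\<^sub>R 1 + ?x *\<^sub>R (2::real))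
      \<le> (1 - ?x) * (ln \<circ> Gamma) 1 + ?x * (ln \<circ> Gamma) (2::real)"
    using assms by (intro convex_onD[OF log_convex_Gamma_real]) (auto simp: field_simps)
  then have "ln (Gamma (?x + 1)) \<le> 0"
    by (simp add: Gamma_numeral algebra_simps)
  moreover have "Gamma (?x + 1) > 0" by (intro Gamma_real_pos add_nonneg_pos) auto
  ultimately have "Gamma (?x + 1) \<le> 1" by simp
  moreover have "Gamma (?x + 1) = ?x * Gamma ?x"
    using assms by (intro Gamma_plus1) (auto dest: nonpos_Ints_nonpos)
  ultimately have "1 / real h * Gamma (1 / real h) \<le> 1" by simp
  then show ?thesis using assms by (simp add: pos_divide_le_eq)
qed

text \<open>The term of index \<open>h\<close> in the series of \<open>exp h\<close> is below its
  sum. Keeping the term of index 0 too makes this strict, which later leaves room for a constant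
  above \<open>1 / exp 1\<close>.\<close>

lemma fact_gt_power_div_exp:
  assumes "h > 0"
  shows "(real h / exp 1) ^ h < fact h"
proof -
  let ?f = "\<lambda>n. real h ^ n /\<^sub>R fact n"
  have "sum ?f {0, h} \<le> suminf ?f"
    using exp_converges[of "real h"] by (intro sum_le_suminf) (auto simp: sums_iff)
  also have "\<dots> = exp (real h)" using exp_converges[of "real h"] by (simp add: sums_iff)
  finally have "1 + real h ^ h / fact h \<le> exp (real h)"
    using assms by (simp add: divide_inverse mult.commute)
  then have "real h ^ h / fact h < exp (real h)" by linarith
  then show ?thesis by (simp add: power_divide field_simps exp_of_nat_mult[symmetric])
qed

section \<open>Comparison of both bounds as \<open>\<sigma>\<close> tends to 0\<close>

lemma basis_counting_constant:
  fixes A :: "nat set" and c U :: real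
  assumes "h \<ge> 2" "multiplicative_basis h A" "c \<ge> 0" "U \<ge> 0"
    and bound: "\<And>u. u > U \<Longrightarrow> real (counting_function A (exp u)) \<le> c * exp u * u powr (1 / real h - 1)"
  shows "fact h \<le> (c * Gamma (1 / real h)) ^ h"
proof -
  define G where "G = Gamma (1 / real h)"
  define C where "C = (\<Sum>n. inverse (real n ^ 2))"
  obtain k where k: "h = Suc (Suc k)" using assms(1) by (metis add_2_eq_Suc le_Suc_ex)
  have A: "0 \<notin> A" using assms(2) by (auto simp: multiplicative_basis_def)
  text \<open>Substituting \<open>\<sigma> = t ^ h\<close> makes the bound polynomial in \<open>t\<close>.\<close>
  have ineq: "1 \<le> ((1 + t ^ h) * (U * t + c * G)) ^ h / fact h + C * t\<^sup>2 * ((1 + t ^ h) * (U * t + c * G)) ^ k"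
    if t: "t > 0" for t :: real
  proof -
    define \<sigma> where "\<sigma> = t ^ h"
    have \<sigma>: "\<sigma> > 0" "\<sigma> powr (1 / real h) = t"
      using t assms(1) by (auto simp: \<sigma>_def powr_realpow[symmetric] powr_powr)
    \<comment> \<open>The bound of \<open>sum_basis_powr_le\<close> for the Dirichlet sum; it does
      not depend on \<open>N\<close>.\<close>
    define P where "P = (1 + \<sigma>) * (U + c * G / t)"
    have main: "(1 - (1 + real N) powr -\<sigma>) / \<sigma> \<le> P ^ h / fact h + C * P ^ k" for N
    proof -
      define B where "B = A \<inter> {1..N}"
      define w where "w n = real n powr -(1 + \<sigma>)" for n
      have P: "sum w B \<le> P"
        using sum_basis_powr_le[OF assms(3) _ \<sigma>(1) assms(4) A bound, of N] assms(1) \<sigma>(2)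
        by (simp add: P_def G_def w_def B_def)
      \<comment> \<open>Bounded by zeta(2), uniformly in \<open>N\<close> and
        \<open>\<sigma>\<close>.\<close>
      have "(\<Sum>b\<in>B. (w b)\<^sup>2) \<le> (\<Sum>b\<in>B. inverse (real b ^ 2))"
      proof (intro sum_mono)
        fix b assume "b \<in> B"
        then have b: "real b \<ge> 1" by (auto simp: B_def)
        have "w b \<le> real b powr -1" unfolding w_def using b \<sigma> by (intro powr_mono) auto
        then have "(w b)\<^sup>2 \<le> (real b powr -1)\<^sup>2" by (intro power_mono) (auto simp: w_def)
        then show "(w b)\<^sup>2 \<le> inverse (real b ^ 2)" using b by (simp add: powr_minus power_inverse)
      qed
      also have "\<dots> \<le> C"
        unfolding C_def by (intro sum_le_suminf inverse_power_summable) (auto simp: B_def)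
      finally have sq: "(\<Sum>b\<in>B. (w b)\<^sup>2) \<le> C" .
      have "(1 - (1 + real N) powr -\<sigma>) / \<sigma> \<le> sum w {1..N}"
        unfolding w_def by (rule sum_powr_ge[OF \<sigma>(1)])
      also have "\<dots> \<le> sum w (products B h)"
        unfolding B_def
        by (intro sum_mono2 finite_products basis_subset_products assms) (auto simp: w_def)
      also have "\<dots> \<le> sum w B ^ h / fact h + (\<Sum>b\<in>B. (w b)\<^sup>2) * sum w B ^ k"
        unfolding k by (rule sum_products_Suc_Suc_le) (auto simp: w_def B_def powr_mult)
      also have "\<dots> \<le> P ^ h / fact h + C * P ^ k"
      proof -
        have "sum w B \<ge> 0" by (auto simp: w_def intro: sum_nonneg)
        moreover have "C \<ge> 0" unfolding C_def by (intro suminf_nonneg inverse_power_summable) auto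
        ultimately show ?thesis using P sq
          by (intro add_mono divide_right_mono mult_mono power_mono) auto
      qed
      finally show ?thesis .
    qed
    have "filterlim (\<lambda>N. 1 + real N) at_top sequentially"
      by (intro filterlim_tendsto_add_at_top[OF tendsto_const] filterlim_real_sequentially)
    then have "(\<lambda>N. (1 + real N) powr -\<sigma>) \<longlonglongrightarrow> 0"
      using \<sigma> by (intro tendsto_neg_powr) auto
    then have "(\<lambda>N. (1 - (1 + real N) powr -\<sigma>) / \<sigma>) \<longlonglongrightarrow> (1 - 0) / \<sigma>"
      using \<sigma> by (intro tendsto_intros) auto
    then have "1 / \<sigma> \<le> P ^ h / fact h + C * P ^ k"
      using main by (intro LIMSEQ_le_const2[of _ "1 / \<sigma>"]) auto
    then have "1 \<le> t ^ h * (P ^ h / fact h + C * P ^ k)"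
      using \<sigma> unfolding \<sigma>_def by (simp add: field_simps)
    \<comment> \<open>As \<open>h = k + 2\<close>, the factor \<open>t ^ h\<close> turns
      \<open>P ^ h\<close> and \<open>P ^ k\<close> into powers of \<open>P * t\<close>, and the
      remainder keeps a factor \<open>t\<^sup>2\<close>.\<close>
    also have "\<dots> = (P * t) ^ h / fact h + C * t\<^sup>2 * (P * t) ^ k"
      by (simp add: k power_mult_distrib power2_eq_square algebra_simps)
    also have "P * t = (1 + t ^ h) * (U * t + c * G)"
      using t by (simp add: P_def \<sigma>_def field_simps)
    finally show ?thesis .
  qed
  let ?F = "\<lambda>t::real. ((1 + t ^ h) * (U * t + c * G)) ^ h / fact h + C * t\<^sup>2 * ((1 + t ^ h) * (U * t + c * G)) ^ k"
  \<comment> \<open>A polynomial in \<open>t\<close>: at 0 the remainder and the part with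
    \<open>U\<close> vanish, leaving \<open>(c * G) ^ h / fact h\<close>.\<close>
  have "isCont ?F 0" by (intro continuous_intros) auto
  then have "(?F \<longlongrightarrow> ?F 0) (at_right 0)"
    by (meson continuous_within filterlim_at_split)
  then have "1 \<le> ?F 0"
    by (rule tendsto_lowerbound)
      (auto intro!: eventually_mono[OF eventually_at_right_less] ineq)
  then show ?thesis using assms(1) by (simp add: G_def power_0_left)
qed

section \<open>The limsup bound\<close>

theorem corollary4:
  fixes h :: nat and A :: "nat set"
  assumes "h \<ge> 2"
    and "multiplicative_basis h A"
  shows "Limsup at_top (\<lambda>x::real.
           ereal (real (counting_function A x) * (ln x powr (1 - 1 / real h) / x)))
         > ereal (1 / exp 1)"
proof (rule ccontr)
  let ?F = "\<lambda>x::real. real (counting_function A x) * (ln x powr (1 - 1 / real h) / x)"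
  assume "\<not> ?thesis"
  then have le: "Limsup at_top (\<lambda>x. ereal (?F x)) \<le> ereal (1 / exp 1)" by simp
  \<comment> \<open>The gap holds a constant \<open>c\<close> that is above the assumed limsup and
    yet satisfies \<open>(c * h) ^ h < fact h\<close>.\<close>
  have "1 / exp 1 < root h (fact h) / real h"
  proof (rule power_less_imp_less_base)
    show "(1 / exp 1) ^ h < (root h (fact h) / real h) ^ h"
      using fact_gt_power_div_exp[of h] assms(1) by (simp add: power_divide field_simps)
  qed (use assms(1) in auto)
  then obtain c where c: "1 / exp 1 < c" "c < root h (fact h) / real h"
    using dense by blast
  have "c > 0" using c(1) by (rule less_trans[rotated]) simp
  from le c(1) have "Limsup at_top (\<lambda>x. ereal (?F x)) < ereal c"
    by (meson ereal_less_eq(3) le_less_trans less_ereal.simps(1))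
  then have "eventually (\<lambda>x. ereal (?F x) < ereal c) at_top"
    by (rule Limsup_lessD)
  then obtain x0 where x0: "\<And>x. x \<ge> x0 \<Longrightarrow> ?F x < c"
    by (auto simp: eventually_at_top_linorder)
  \<comment> \<open>The threshold \<open>x0\<close> on the scale \<open>u = ln x\<close>;
    \<open>max 1\<close> keeps the argument of \<open>ln\<close> positive.\<close>
  define U where "U = max 0 (ln (max 1 x0))"
  have "real (counting_function A (exp u)) \<le> c * exp u * u powr (1 / real h - 1)" if "u > U" for u
  proof -
    have "u > 0" "ln (max 1 x0) < u" using that unfolding U_def max_less_iff_conj by auto
    moreover from this(2) have "exp (ln (max 1 x0)) < exp u" by (simp only: exp_less_cancel_iff)
    ultimately have u: "u > 0" "exp u \<ge> x0" by auto
    have "?F (exp u) \<le> c" using x0[OF u(2)] by simp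
    moreover have "u powr (1 - 1 / real h) = inverse (u powr (1 / real h - 1))"
      by (simp flip: powr_minus)
    ultimately show ?thesis using u by (simp add: field_simps)
  qed
  then have "fact h \<le> (c * Gamma (1 / real h)) ^ h"
    using \<open>c > 0\<close> by (intro basis_counting_constant[OF assms, of c U]) (auto simp: U_def)
  also have "\<dots> \<le> (c * real h) ^ h"
    using \<open>c > 0\<close> assms(1) Gamma_inverse_le[of h]
    by (intro power_mono mult_left_mono mult_nonneg_nonneg) (auto intro: less_imp_le Gamma_real_pos)
  also have "\<dots> < root h (fact h) ^ h"
    using c(2) \<open>c > 0\<close> assms(1) by (intro power_strict_mono) (auto simp: field_simps)
  also have "\<dots> = fact h" using assms(1) by simp
  finally show False by simp
qed

end
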